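(* Let $\mathcal I,\mathcal J$ be ideals on $\omega$ and let $\mathcal F,\mathcal G\subseteq\omega^\omega$. If $\mathcal G$ contains the identity function, then $\mathfrak u(\mathcal I,\mathcal F,\mathcal J,\mathcal G)>|\mathcal F|$ if and only if there exists an ultrafilter $\mathcal U$ on $\omega$ such that $\mathcal I\not\le_{\mathcal F}\mathcal U^*$ and $\mathcal J\le_{\mathcal G}\mathcal U^*$.
   Context: An ideal on $\omega$ is a family of subsets of $\omega$ closed under finite unions and subsets, containing all finite sets and not containing $\omega$. Ultrafilters on $\omega$ contain all cofinite sets; $\mathcal U^*=\{\omega\setminus A:A\in\mathcal U\}$ is the dual ideal. For $\mathcal F\subseteq\omega^\omega$ and ideals $\mathcal I,\mathcal K$ on $\omega$, $\mathcal I\le_{\mathcal F}\mathcal K$ means that there is $f\in\mathcal F$ with $f^{-1}[B]\in\mathcal K$ for every $B\in\mathcal I$. For an ideal $\mathcal K$ on $\omega$ and $\mathcal A\subseteq\mathcal P(\omega)$ let $\mathcal K(\mathcal A)=\{B\subseteq\omega:\exists F\in[\mathcal A]^{<\omega}\ (B\setminus\bigcup F\in\mathcal K)\}$; it is an ideal exactly when $\omega\notin\mathcal K(\mathcal A)$. For a cardinal $\lambda\le\mathfrak c=2^{\aleph_0}$, $\mathcal I\preceq^\lambda_{\mathcal F,\mathcal G}\mathcal J$ means: for each ideal $\mathcal J'$ on $\omega$ with $\mathcal J\le_{\mathcal G}\mathcal J'$ there exists $\mathcal A\subseteq\mathcal P(\omega)$ with $|\mathcal A|<\lambda$ such that $\omega\notin\mathcal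 J'(\mathcal A)$ and $\mathcal I\le_{\mathcal F}\mathcal J'(\mathcal A)$. Finally $$\mathfrak u(\mathcal I,\mathcal F,\mathcal J,\mathcal G)=\min\left(\{\lambda\le\mathfrak c:\mathcal I\preceq^\lambda_{\mathcal F,\mathcal G}\mathcal J\}\cup\{\mathfrak c^+\}\right).$$ *)

theory Defs
  imports Main
begin

unbundle cardinal_syntax

definition is_ideal :: "nat set set \<Rightarrow> bool" where
  "is_ideal I \<longleftrightarrow>
     (\<forall>A\<in>I. \<forall>B\<in>I. A \<union> B \<in> I) \<and>
     (\<forall>A\<in>I. \<forall>B. B \<subseteq> A \<longrightarrow> B \<in> I) \<and>
     (\<forall>A. finite A \<longrightarrow> A \<in> I) \<and>
     UNIV \<notin> I"

definition is_ultrafilter :: "nat set set \<Rightarrow> bool" where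
  "is_ultrafilter U \<longleftrightarrow>
     (\<forall>A\<in>U. \<forall>B\<in>U. A \<inter> B \<in> U) \<and>
     (\<forall>A\<in>U. \<forall>B. A \<subseteq> B \<longrightarrow> B \<in> U) \<and>
     {} \<notin> U \<and>
     (\<forall>A. A \<in> U \<or> - A \<in> U) \<and>
     (\<forall>A. finite (- A) \<longrightarrow> A \<in> U)"

definition dual_ideal :: "nat set set \<Rightarrow> nat set set" where
  "dual_ideal U = {UNIV - A | A. A \<in> U}"

definition below_via :: "nat set set \<Rightarrow> (nat \<Rightarrow> nat) set \<Rightarrow> nat set set \<Rightarrow> bool" where
  "below_via I F K \<longleftrightarrow> (\<exists>f\<in>F. \<forall>B\<in>I. f -` B \<in> K)"

definition ideal_ext :: "nat set set \<Rightarrow> nat set set \<Rightarrow> nat set set" where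
  "ideal_ext K A = {B. \<exists>E. finite E \<and> E \<subseteq> A \<and> B - \<Union>E \<in> K}"

abbreviation continuum :: "nat set rel" where
  "continuum \<equiv> |UNIV :: nat set set|"

text \<open>
  Cardinals are cardinal orders in the sense of \<^const>\<open>Card_order\<close>, finite ones included, and are
  compared by \<open>\<le>o\<close> and \<open><o\<close>, that is, up to order isomorphism. They are taken on the type
  \<^typ>\<open>nat set set\<close>, the underlying type of \<^term>\<open>cardSuc continuum\<close>, on which every cardinal up to
  the successor of the continuum is represented.
\<close>

definition prec_ideal ::
  "nat set set rel \<Rightarrow> (nat \<Rightarrow> nat) set \<Rightarrow> (nat \<Rightarrow> nat) set \<Rightarrow> nat set set \<Rightarrow> nat set set \<Rightarrow> bool" where
  "prec_ideal l F G I J \<longleftrightarrow>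
     (\<forall>J'. is_ideal J' \<and> below_via J G J' \<longrightarrow>
       (\<exists>A :: nat set set. |A| <o l \<and> UNIV \<notin> ideal_ext J' A \<and> below_via I F (ideal_ext J' A)))"

definition u_candidates ::
  "nat set set \<Rightarrow> (nat \<Rightarrow> nat) set \<Rightarrow> nat set set \<Rightarrow> (nat \<Rightarrow> nat) set \<Rightarrow> nat set set rel set" where
  "u_candidates I F J G =
     {l. Card_order l \<and> l \<le>o continuum \<and> prec_ideal l F G I J} \<union> {cardSuc continuum}"

text \<open>
  The minimum is determined only up to \<open>=o\<close>, so a representative is chosen.
\<close>

definition u_inv ::
  "nat set set \<Rightarrow> (nat \<Rightarrow> nat) set \<Rightarrow> nat set set \<Rightarrow> (nat \<Rightarrow> nat) set \<Rightarrow> nat set set rel" where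
  "u_inv I F J G =
     (SOME l. l \<in> u_candidates I F J G \<and> (\<forall>l'\<in>u_candidates I F J G. l \<le>o l'))"

lemma u_inv_is_minimum:
  "u_inv I F J G \<in> u_candidates I F J G \<and> (\<forall>l\<in>u_candidates I F J G. u_inv I F J G \<le>o l)"
proof -
  have "u_candidates I F J G \<noteq> {}" "\<forall>l\<in>u_candidates I F J G. Card_order l"
    by (auto simp: u_candidates_def cardSuc_Card_order card_of_Card_order)
  from exists_minim_Card_order[OF this] show ?thesis
    unfolding u_inv_def Bex_def by (rule someI_ex)
qed

end

theory Submission
  imports Defs "HOL-Library.Nat_Bijection"
begin

text \<open>
  An ideal \<open>\<U>\<^sup>*\<close> dual to an ultrafilter is maximal: \<open>\<U>\<^sup>*(\<A>)\<close> is either improper or \<open>\<U>\<^sup>*\<close>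
  itself. Hence an ultrafilter as in the theorem, taken as \<open>\<J>'\<close>, refutes
  \<open>\<I> \<preceq>\<^sup>\<lambda> \<J>\<close> for every \<open>\<lambda> \<le> \<cc>\<close>, and the invariant is \<open>\<cc>\<^sup>+\<close>. Conversely, if some \<open>\<J>'\<close>
  refutes it for \<open>\<lambda> = |\<F>|\<close>, run through \<open>\<F>\<close> along a well-order of type \<open>|\<F>|\<close>: before \<open>f\<close> is
  treated, fewer than \<open>|\<F>|\<close> sets have been added to \<open>\<J>'\<close>, so some \<open>B \<in> \<I>\<close> has a preimage
  \<open>f\<^sup>-\<^sup>1[B]\<close> outside the current ideal, and the complement of that preimage can be added. Any
  ultrafilter whose dual ideal contains \<open>\<J>'\<close> and all the added sets works.
\<close>

section \<open>Ideals and their extensions by a family of sets\<close>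

lemma is_ideal_Un: "is_ideal K \<Longrightarrow> A \<in> K \<Longrightarrow> B \<in> K \<Longrightarrow> A \<union> B \<in> K"
  unfolding is_ideal_def by blast

lemma is_ideal_mono: "is_ideal K \<Longrightarrow> A \<in> K \<Longrightarrow> B \<subseteq> A \<Longrightarrow> B \<in> K"
  unfolding is_ideal_def by blast

lemma is_ideal_finite: "is_ideal K \<Longrightarrow> finite A \<Longrightarrow> A \<in> K"
  unfolding is_ideal_def by blast

lemma is_ideal_UNIV: "is_ideal K \<Longrightarrow> UNIV \<notin> K"
  unfolding is_ideal_def by blast

lemma subset_ideal_ext: "K \<subseteq> ideal_ext K A"
  unfolding ideal_ext_def by (auto intro!: exI[of _ "{}"])

lemma generators_subset_ideal_ext:
  assumes "is_ideal K"
  shows "A \<subseteq> ideal_ext K A"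
proof
  fix a assume "a \<in> A"
  moreover have "a - \<Union>{a} \<in> K"
    using assms by (simp add: is_ideal_finite)
  ultimately show "a \<in> ideal_ext K A"
    unfolding ideal_ext_def by (intro CollectI exI[of _ "{a}"]) simp
qed

lemma is_ideal_ideal_ext:
  assumes K: "is_ideal K" and proper: "UNIV \<notin> ideal_ext K A"
  shows "is_ideal (ideal_ext K A)"
  unfolding is_ideal_def
proof (intro conjI ballI allI impI)
  fix B C assume "B \<in> ideal_ext K A" "C \<in> ideal_ext K A"
  then obtain D E where D: "finite D" "D \<subseteq> A" "B - \<Union>D \<in> K"
    and E: "finite E" "E \<subseteq> A" "C - \<Union>E \<in> K"
    unfolding ideal_ext_def by blast
  have "B \<union> C - \<Union>(D \<union> E) \<in> K"
    by (rule is_ideal_mono[OF K is_ideal_Un[OF K D(3) E(3)]]) blast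
  with D E show "B \<union> C \<in> ideal_ext K A"
    unfolding ideal_ext_def by (intro CollectI exI[of _ "D \<union> E"]) simp
next
  fix B C assume "B \<in> ideal_ext K A" "C \<subseteq> B"
  then obtain E where E: "finite E" "E \<subseteq> A" "B - \<Union>E \<in> K"
    unfolding ideal_ext_def by blast
  have "C - \<Union>E \<in> K"
    using is_ideal_mono[OF K E(3)] \<open>C \<subseteq> B\<close> by (simp add: Diff_mono)
  with E show "C \<in> ideal_ext K A"
    unfolding ideal_ext_def by blast
next
  fix B :: "nat set" assume "finite B"
  then show "B \<in> ideal_ext K A"
    using is_ideal_finite[OF K] subset_ideal_ext by blast
qed (rule proper)

section \<open>Dual ideals of ultrafilters and maximal ideals\<close>

lemma mem_dual_ideal_iff: "A \<in> dual_ideal U \<longleftrightarrow> - A \<in> U"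
  unfolding dual_ideal_def by (auto simp: Compl_eq_Diff_UNIV[symmetric] intro!: exI[of _ "- A"])

lemma is_ideal_dual_ideal:
  assumes "is_ultrafilter U"
  shows "is_ideal (dual_ideal U)"
  unfolding is_ideal_def
proof (intro conjI ballI allI impI)
  fix A B assume "A \<in> dual_ideal U" "B \<in> dual_ideal U"
  then show "A \<union> B \<in> dual_ideal U"
    using assms by (simp add: mem_dual_ideal_iff is_ultrafilter_def)
next
  fix A B assume "A \<in> dual_ideal U" "B \<subseteq> A"
  then show "B \<in> dual_ideal U"
    using assms unfolding mem_dual_ideal_iff is_ultrafilter_def by (meson Compl_anti_mono)
qed (use assms in \<open>simp_all add: mem_dual_ideal_iff is_ultrafilter_def\<close>)

text \<open>Of any set and its complement, one lies in the dual ideal. A set gained by the extension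
  would therefore meet its complement there, and their union is \<open>UNIV\<close>.\<close>

lemma ideal_ext_dual_ideal:
  assumes U: "is_ultrafilter U" and proper: "UNIV \<notin> ideal_ext (dual_ideal U) A"
  shows "ideal_ext (dual_ideal U) A = dual_ideal U"
proof
  have id: "is_ideal (ideal_ext (dual_ideal U) A)"
    using is_ideal_dual_ideal[OF U] proper by (rule is_ideal_ideal_ext)
  show "ideal_ext (dual_ideal U) A \<subseteq> dual_ideal U"
  proof
    fix B assume B: "B \<in> ideal_ext (dual_ideal U) A"
    show "B \<in> dual_ideal U"
    proof (rule ccontr)
      assume "B \<notin> dual_ideal U"
      then have "- B \<in> dual_ideal U"
        using U unfolding mem_dual_ideal_iff is_ultrafilter_def by auto
      then have "- B \<in> ideal_ext (dual_ideal U) A"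
        using subset_ideal_ext by blast
      from is_ideal_Un[OF id B this] proper show False by simp
    qed
  qed
qed (rule subset_ideal_ext)

lemma is_ideal_Union_chain:
  assumes "\<C> \<noteq> {}" and ideal: "\<And>K. K \<in> \<C> \<Longrightarrow> is_ideal K"
    and chain: "\<And>K L. K \<in> \<C> \<Longrightarrow> L \<in> \<C> \<Longrightarrow> K \<subseteq> L \<or> L \<subseteq> K"
  shows "is_ideal (\<Union>\<C>)"
  unfolding is_ideal_def
proof (intro conjI ballI allI impI)
  fix A B assume "A \<in> \<Union>\<C>" "B \<in> \<Union>\<C>"
  then obtain K where "K \<in> \<C>" "A \<in> K" "B \<in> K"
    using chain by blast
  then show "A \<union> B \<in> \<Union>\<C>"
    using is_ideal_Un[OF ideal] by blast
next
  fix A B assume "A \<in> \<Union>\<C>" "B \<subseteq> A"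
  then show "B \<in> \<Union>\<C>"
    using is_ideal_mono[OF ideal] by blast
next
  fix A :: "nat set" assume "finite A"
  then show "A \<in> \<Union>\<C>"
    using is_ideal_finite[OF ideal] \<open>\<C> \<noteq> {}\<close> by blast
next
  show "UNIV \<notin> \<Union>\<C>"
    using is_ideal_UNIV[OF ideal] by blast
qed

text \<open>Zorn's lemma yields a maximal ideal \<open>M\<close> above \<open>K\<close>; the
  complements of its members form the ultrafilter.\<close>

lemma ideal_subset_dual_ideal_ultrafilter:
  assumes K: "is_ideal K"
  obtains U where "is_ultrafilter U" "K \<subseteq> dual_ideal U"
proof -
  let ?Z = "{L. is_ideal L \<and> K \<subseteq> L}"
  have "\<exists>M\<in>?Z. \<forall>L\<in>?Z. M \<subseteq> L \<longrightarrow> L = M" (is "\<exists>M\<in>_. ?max M")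
  proof (rule subset_Zorn_nonempty)
    show "?Z \<noteq> {}" using K by blast
    fix \<C> assume "\<C> \<noteq> {}" and C: "subset.chain ?Z \<C>"
    have "is_ideal (\<Union>\<C>)"
      using \<open>\<C> \<noteq> {}\<close> C by (intro is_ideal_Union_chain) (auto simp: subset_chain_def)
    moreover have "K \<subseteq> \<Union>\<C>"
      using \<open>\<C> \<noteq> {}\<close> C unfolding subset_chain_def by fast
    ultimately show "\<Union>\<C> \<in> ?Z" by blast
  qed
  then obtain M where "M \<in> ?Z" and max: "?max M"
    by (rule bexE)
  then have M: "is_ideal M" "K \<subseteq> M"
    by simp_all
  have maximal: "L = M" if "is_ideal L" "M \<subseteq> L" for L
    using max M(2) that by simp
  \<comment> \<open>Try to adjoin \<open>A\<close> to \<open>M\<close>. If the result is improper,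
    \<open>A\<close> covers everything up to a set in \<open>M\<close>, so \<open>- A\<close> is in
    \<open>M\<close>; otherwise maximality puts \<open>A\<close> into \<open>M\<close>.\<close>
  have total: "A \<in> M \<or> - A \<in> M" for A
  proof (cases "UNIV \<in> ideal_ext M {A}")
    case True
    then obtain E where "E \<subseteq> {A}" "UNIV - \<Union>E \<in> M"
      unfolding ideal_ext_def by blast
    then have "- A \<in> M"
      by (blast intro: is_ideal_mono[OF M(1)])
    then show ?thesis ..
  next
    case False
    then have "ideal_ext M {A} = M"
      using is_ideal_ideal_ext[OF M(1)] subset_ideal_ext maximal by blast
    then show ?thesis
      using generators_subset_ideal_ext[OF M(1), of "{A}"] by blast
  qed
  let ?U = "{A. - A \<in> M}"
  have "is_ultrafilter ?U"
    unfolding is_ultrafilter_def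
    using M(1) total by (auto simp: is_ideal_def)
  moreover have "K \<subseteq> dual_ideal ?U"
    using M(2) by (auto simp: mem_dual_ideal_iff)
  ultimately show thesis by (rule that)
qed

section \<open>Choosing sets along a well-order of \<open>F\<close>\<close>

lemma Linear_order_finite_max:
  assumes r: "Linear_order r" and "finite T" "T \<noteq> {}" "T \<subseteq> Field r"
  shows "\<exists>m\<in>T. T - {m} \<subseteq> underS r m"
  using assms(2-)
proof (induction rule: finite_ne_induct)
  case (insert x T)
  then obtain m where m: "m \<in> T" "T - {m} \<subseteq> underS r m" by auto
  have "x \<noteq> m" using insert m by auto
  then consider "(x, m) \<in> r" | "(m, x) \<in> r"
    using r insert.prems m(1) unfolding order_on_defs total_on_def by blast
  then show ?case
  proof cases
    case 1
    then show ?thesis using m \<open>x \<noteq> m\<close> by (auto simp: underS_def)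
  next
    case 2
    have "T \<subseteq> underS r x"
    proof
      fix y assume y: "y \<in> T"
      then have "(y, m) \<in> r \<or> y = m"
        using m(2) by (auto simp: underS_def)
      then have "(y, x) \<in> r"
        using 2 r unfolding order_on_defs by (blast dest: transD)
      then show "y \<in> underS r x"
        using y insert.hyps by (auto simp: underS_def)
    qed
    then show ?thesis by blast
  qed
qed simp

text \<open>
  A violation of properness uses finitely many of the sets \<open>- D f\<close>; the last of their indices
  contradicts the hypothesis.
\<close>

lemma UNIV_notin_ideal_ext_successive:
  assumes r: "Linear_order r" and K: "is_ideal K" and S: "S \<subseteq> Field r"
    and D: "\<And>f. f \<in> S \<Longrightarrow> D f \<notin> ideal_ext K ((\<lambda>g. - D g) ` underS r f)"
  shows "UNIV \<notin> ideal_ext K ((\<lambda>g. - D g) ` S)"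
proof
  assume "UNIV \<in> ideal_ext K ((\<lambda>g. - D g) ` S)"
  then obtain E where E: "finite E" "E \<subseteq> (\<lambda>g. - D g) ` S" "UNIV - \<Union>E \<in> K"
    unfolding ideal_ext_def by blast
  obtain T where T: "T \<subseteq> S" "finite T" "E = (\<lambda>g. - D g) ` T"
    using finite_subset_image[OF E(1,2)] by blast
  show False
  proof (cases "T = {}")
    case True
    with T E(3) is_ideal_UNIV[OF K] show False by simp
  next
    case False
    have "T \<subseteq> Field r" using T(1) S by blast
    from Linear_order_finite_max[OF r T(2) False this]
    obtain m where m: "m \<in> T" "T - {m} \<subseteq> underS r m" by blast
    \<comment> \<open>Points of \<open>D m\<close> already avoid \<open>- D m\<close>, so dropping
      \<open>m\<close> from the index set \<open>T\<close> removes nothing more from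
      \<open>D m\<close>.\<close>
    have "D m - \<Union>((\<lambda>g. - D g) ` (T - {m})) \<subseteq> UNIV - \<Union>E"
      using T(3) by auto
    then have "D m - \<Union>((\<lambda>g. - D g) ` (T - {m})) \<in> K"
      by (rule is_ideal_mono[OF K E(3)])
    then have "D m \<in> ideal_ext K ((\<lambda>g. - D g) ` underS r m)"
      unfolding ideal_ext_def using T(2) m(2)
      by (intro CollectI exI[of _ "(\<lambda>g. - D g) ` (T - {m})"]) auto
    then show False using D m(1) T(1) by blast
  qed
qed

lemma ultrafilter_avoiding_below_via:
  fixes F :: "(nat \<Rightarrow> nat) set"
  assumes K: "is_ideal K"
    and avoid: "\<And>A :: nat set set. |A| <o |F| \<Longrightarrow> UNIV \<notin> ideal_ext K A \<Longrightarrow>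
      \<not> below_via I F (ideal_ext K A)"
  obtains U where "is_ultrafilter U" "K \<subseteq> dual_ideal U" "\<not> below_via I F (dual_ideal U)"
proof -
  define r where "r = |F|"
  have card: "Card_order r" and field: "Field r = F"
    unfolding r_def by (rule card_of_Card_order, rule Field_card_of)
  then have well: "Well_order r"
    by (simp add: card_order_on_well_order_on)
  then have linear: "Linear_order r"
    unfolding well_order_on_def by blast
  \<comment> \<open>\<open>b g\<close> is the member of \<open>I\<close> chosen for
    \<open>g\<close>, and \<open>C b g\<close> is the set then added to the ideal.\<close>
  define C where "C b g = - (g -` b g)" for b :: "(nat \<Rightarrow> nat) \<Rightarrow> nat set" and g :: "nat \<Rightarrow> nat"
  have "\<exists>b. \<forall>f. f \<in> F \<longrightarrow> b f \<in> I \<and> f -` b f \<notin> ideal_ext K (C b ` underS r f)"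
  \<comment> \<open>Well-founded recursion with choice: the condition at \<open>f\<close> depends on
    \<open>b\<close> only at strict predecessors of \<open>f\<close>. The guard
    \<open>f \<in> F\<close> makes it trivial off \<open>F\<close>, since \<open>b\<close> is
    total.\<close>
  proof (rule dependent_wf_choice)
    show "wf (r - Id)"
      using well unfolding well_order_on_def by blast
  next
    fix b b' :: "(nat \<Rightarrow> nat) \<Rightarrow> nat set" and f B
    assume "\<And>g. (g, f) \<in> r - Id \<Longrightarrow> b g = b' g"
    then have "C b ` underS r f = C b' ` underS r f"
      by (intro image_cong) (auto simp: underS_def C_def)
    then show "(f \<in> F \<longrightarrow> B \<in> I \<and> f -` B \<notin> ideal_ext K (C b ` underS r f)) =
        (f \<in> F \<longrightarrow> B \<in> I \<and> f -` B \<notin> ideal_ext K (C b' ` underS r f))"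
      by simp
  next
    fix f b
    assume IH: "\<And>g. (g, f) \<in> r - Id \<Longrightarrow>
      g \<in> F \<longrightarrow> b g \<in> I \<and> g -` b g \<notin> ideal_ext K (C b ` underS r g)"
    show "\<exists>B. f \<in> F \<longrightarrow> B \<in> I \<and> f -` B \<notin> ideal_ext K (C b ` underS r f)"
    proof (cases "f \<in> F")
      case True
      have sub: "underS r f \<subseteq> F"
        using field by (auto simp: underS_def Field_def)
      have "|C b ` underS r f| \<le>o |underS r f|"
        by (rule card_of_image)
      \<comment> \<open>Here it matters that \<open>r\<close> is a cardinal order: its proper
        initial segments have cardinality below \<open>|F|\<close>, as \<open>avoid\<close>
        demands.\<close>
      also have "|underS r f| <o r"
        using card True field by (intro card_of_underS) auto
      finally have "|C b ` underS r f| <o |F|"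
        unfolding r_def .
      \<comment> \<open>Properness at this stage follows from the choices made at all earlier ones,
        so successor and limit stages are treated alike.\<close>
      moreover have "UNIV \<notin> ideal_ext K (C b ` underS r f)"
        unfolding C_def
      proof (rule UNIV_notin_ideal_ext_successive[OF linear K])
        fix g assume "g \<in> underS r f"
        with IH sub show "g -` b g \<notin> ideal_ext K ((\<lambda>g. - (g -` b g)) ` underS r g)"
          unfolding C_def[abs_def] by (auto simp: underS_def)
      qed (simp add: sub field)
      ultimately have "\<not> below_via I F (ideal_ext K (C b ` underS r f))"
        by (rule avoid)
      then show ?thesis
        using True unfolding below_via_def by blast
    qed simp
  qed
  then obtain b where b: "\<And>f. f \<in> F \<Longrightarrow> b f \<in> I"
      "\<And>f. f \<in> F \<Longrightarrow> f -` b f \<notin> ideal_ext K (C b ` underS r f)"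
    by blast
  have "UNIV \<notin> ideal_ext K (C b ` F)"
    using UNIV_notin_ideal_ext_successive[OF linear K, of F "\<lambda>f. f -` b f"] b(2) field
    unfolding C_def[abs_def] by simp
  with K have "is_ideal (ideal_ext K (C b ` F))"
    by (rule is_ideal_ideal_ext)
  then obtain U where U: "is_ultrafilter U" "ideal_ext K (C b ` F) \<subseteq> dual_ideal U"
    by (rule ideal_subset_dual_ideal_ultrafilter)
  have "\<not> below_via I F (dual_ideal U)"
  proof
    assume "below_via I F (dual_ideal U)"
    then obtain f where f: "f \<in> F" "f -` b f \<in> dual_ideal U"
      unfolding below_via_def using b(1) by blast
    \<comment> \<open>The dual ideal would contain the preimage of \<open>b f\<close> under
      \<open>f\<close> together with its complement.\<close>
    moreover have "C b f \<in> dual_ideal U"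
      using f(1) generators_subset_ideal_ext[OF K] U(2) by blast
    ultimately have "UNIV \<in> dual_ideal U"
      using is_ideal_Un[OF is_ideal_dual_ideal[OF U(1)]] unfolding C_def by fastforce
    then show False
      using is_ideal_UNIV[OF is_ideal_dual_ideal[OF U(1)]] by blast
  qed
  moreover have "K \<subseteq> dual_ideal U"
    using U(2) subset_ideal_ext by blast
  ultimately show thesis
    using that U(1) by blast
qed

section \<open>Cardinality bounds and the equivalence\<close>

lemma card_of_nat_fun_le_continuum:
  fixes F :: "(nat \<Rightarrow> nat) set"
  shows "|F| \<le>o continuum"
proof -
  \<comment> \<open>A function is coded by its graph, with pairs encoded as natural numbers.\<close>
  have "inj (\<lambda>f :: nat \<Rightarrow> nat. (\<lambda>n. prod_encode (n, f n)) ` UNIV)"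
  proof (rule injI, rule ext)
    fix f g :: "nat \<Rightarrow> nat" and n
    assume "range (\<lambda>n. prod_encode (n, f n)) = range (\<lambda>n. prod_encode (n, g n))"
    then have "prod_encode (n, f n) \<in> range (\<lambda>n. prod_encode (n, g n))" by blast
    then show "f n = g n" by auto
  qed
  then have "inj_on (\<lambda>f :: nat \<Rightarrow> nat. (\<lambda>n. prod_encode (n, f n)) ` UNIV) F"
    by (rule inj_on_subset) simp
  then show ?thesis
    by (intro card_of_ordLeqI) auto
qed

lemma below_via_mono: "below_via I F K \<Longrightarrow> K \<subseteq> L \<Longrightarrow> below_via I F L"
  unfolding below_via_def by blast

theorem theorem3p4:
  fixes I J :: "nat set set" and F G :: "(nat \<Rightarrow> nat) set"
  assumes "is_ideal I" and "is_ideal J" and "id \<in> G"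
  shows "|F| <o u_inv I F J G \<longleftrightarrow>
    (\<exists>U. is_ultrafilter U \<and> \<not> below_via I F (dual_ideal U) \<and> below_via J G (dual_ideal U))"
proof
  assume less: "|F| <o u_inv I F J G"
  \<comment> \<open>\<open>prec_ideal\<close> takes cardinals on the type
    \<open>nat set set\<close>, whereas \<open>|F|\<close> lives on functions; \<open>l\<close> is a
    copy of \<open>|F|\<close> on the right type.\<close>
  have "|F| \<le>o |UNIV :: nat set set set|"
    using card_of_nat_fun_le_continuum card_of_Pow[of "UNIV :: nat set set"]
    by (auto intro: ordLeq_transitive ordLess_imp_ordLeq)
  then obtain h :: "(nat \<Rightarrow> nat) \<Rightarrow> nat set set" where "inj_on h F"
    unfolding card_of_ordLeq[symmetric] by blast
  define l where "l = |h ` F|"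
  have "Card_order l"
    unfolding l_def by (rule card_of_Card_order)
  have eq: "l =o |F|"
    unfolding l_def using \<open>inj_on h F\<close> card_of_ordIso bij_betw_imageI ordIso_symmetric by blast
  have "\<not> prec_ideal l F G I J"
  proof
    assume "prec_ideal l F G I J"
    \<comment> \<open>Since \<open>l\<close> is at most the continuum, it would be a candidate, and
      the minimum could not exceed \<open>|F|\<close>.\<close>
    then have "l \<in> u_candidates I F J G"
      unfolding u_candidates_def
      using ordIso_ordLeq_trans[OF eq card_of_nat_fun_le_continuum] \<open>Card_order l\<close> by blast
    then have "u_inv I F J G \<le>o l"
      using u_inv_is_minimum by blast
    with eq have "u_inv I F J G \<le>o |F|"
      by (blast intro: ordLeq_ordIso_trans)
    with less show False
      by (blast dest: not_ordLess_ordLeq)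
  qed
  then obtain K where K: "is_ideal K" "below_via J G K"
    and avoid: "\<And>A :: nat set set. |A| <o l \<Longrightarrow> UNIV \<notin> ideal_ext K A \<Longrightarrow>
      \<not> below_via I F (ideal_ext K A)"
    unfolding prec_ideal_def by blast
  obtain U where "is_ultrafilter U" "K \<subseteq> dual_ideal U" "\<not> below_via I F (dual_ideal U)"
    using ultrafilter_avoiding_below_via[OF K(1)] avoid
      ordLess_ordIso_trans[OF _ ordIso_symmetric[OF eq]] by metis
  with K(2) show "\<exists>U. is_ultrafilter U \<and> \<not> below_via I F (dual_ideal U) \<and> below_via J G (dual_ideal U)"
    using below_via_mono by blast
next
  assume "\<exists>U. is_ultrafilter U \<and> \<not> below_via I F (dual_ideal U) \<and> below_via J G (dual_ideal U)"
  then obtain U where U: "is_ultrafilter U" "\<not> below_via I F (dual_ideal U)"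
    "below_via J G (dual_ideal U)" by blast
  \<comment> \<open>The witness for \<open>J'\<close> is \<open>dual_ideal U\<close>: every
    extension of it that stays proper equals it, whatever the size of \<open>A\<close>.\<close>
  have "\<not> prec_ideal l F G I J" for l
    unfolding prec_ideal_def
    using U is_ideal_dual_ideal[OF U(1)] ideal_ext_dual_ideal[OF U(1)] by metis
  then have "u_candidates I F J G = {cardSuc continuum}"
    unfolding u_candidates_def by blast
  then have "u_inv I F J G = cardSuc continuum"
    using u_inv_is_minimum[of I F J G] by blast
  then show "|F| <o u_inv I F J G"
    using card_of_nat_fun_le_continuum cardSuc_greater[OF card_of_Card_order] ordLeq_ordLess_trans
    by metis
qed

end
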